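(* Let $G$ be a connected $d$-regular graph of order $n\geq 3$ and let $k$ be an integer such that $1\leq k<d$. Then $\gamma_k^{\mathrm L}(G)=\gamma_{1,d-k}(G)$.
   Context: All graphs are finite, simple and undirected; $\delta(G)$ and $\Delta(G)$ are the minimum and maximum degree and $N(v)$ is the open neighborhood of $v$. A dominating set of $G$ is a set $D\subseteq V(G)$ such that every vertex not in $D$ has a neighbor in $D$. For an integer $0\le k\le \Delta(G)$, a set $D\subseteq V(G)$ is a $k$-limited dominating set if $D$ is a dominating set and $|N(u)-D|\le k$ for every $u\in D$. $\gamma_k^{\mathrm L}(G)$ is the minimum cardinality of a $k$-limited dominating set of $G$. For an integer $t\ge 1$ and a graph $G$ with $\delta(G)\ge t$, a set $S\subseteq V(G)$ is a $(1,t)$-dominating set if every vertex in $V(G)-S$ has at least one neighbor in $S$ and every vertex in $S$ has at least $t$ neighbors in $S$; $\gamma_{1,t}(G)$ is the minimum cardinality of a $(1,t)$-dominating set. *)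

theory Defs
  imports "Graph_Theory.Digraph_Component"
begin

(* A finite simple undirected graph is an instance of the locale graph: a finite, loop-free
   digraph without multiple arcs whose arc relation is symmetric, so that each undirected edge is
   a pair of opposite arcs and the degree of a vertex is its out_degree. *)

definition open_nbhd :: "('a, 'b) pre_digraph \<Rightarrow> 'a \<Rightarrow> 'a set" where
  "open_nbhd G v = {u \<in> verts G. v \<rightarrow>\<^bsub>G\<^esub> u}"

definition min_degree :: "('a, 'b) pre_digraph \<Rightarrow> nat" where
  "min_degree G = Min (out_degree G ` verts G)"

definition max_degree :: "('a, 'b) pre_digraph \<Rightarrow> nat" where
  "max_degree G = Max (out_degree G ` verts G)"

definition regular :: "nat \<Rightarrow> ('a, 'b) pre_digraph \<Rightarrow> bool" where
  "regular d G \<longleftrightarrow> (\<forall>v\<in>verts G. out_degree G v = d)"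

definition dominating_set :: "('a, 'b) pre_digraph \<Rightarrow> 'a set \<Rightarrow> bool" where
  "dominating_set G D \<longleftrightarrow>
     D \<subseteq> verts G \<and> (\<forall>v\<in>verts G - D. open_nbhd G v \<inter> D \<noteq> {})"

(* Intended for k \<le> max_degree G. *)
definition limited_dominating_set :: "nat \<Rightarrow> ('a, 'b) pre_digraph \<Rightarrow> 'a set \<Rightarrow> bool" where
  "limited_dominating_set k G D \<longleftrightarrow>
     dominating_set G D \<and> (\<forall>u\<in>D. card (open_nbhd G u - D) \<le> k)"

definition limited_domination_number :: "nat \<Rightarrow> ('a, 'b) pre_digraph \<Rightarrow> nat" where
  "limited_domination_number k G =
     (LEAST m. \<exists>D. limited_dominating_set k G D \<and> card D = m)"

(* Intended for 1 \<le> t \<le> min_degree G, where the set of all vertices qualifies. *)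
definition one_t_dominating_set :: "nat \<Rightarrow> ('a, 'b) pre_digraph \<Rightarrow> 'a set \<Rightarrow> bool" where
  "one_t_dominating_set t G S \<longleftrightarrow>
     S \<subseteq> verts G \<and>
     (\<forall>v\<in>verts G - S. card (open_nbhd G v \<inter> S) \<ge> 1) \<and>
     (\<forall>v\<in>S. card (open_nbhd G v \<inter> S) \<ge> t)"

definition one_t_domination_number :: "nat \<Rightarrow> ('a, 'b) pre_digraph \<Rightarrow> nat" where
  "one_t_domination_number t G =
     (LEAST m. \<exists>S. one_t_dominating_set t G S \<and> card S = m)"

lemma (in graph) card_open_nbhd:
  assumes "v \<in> verts G"
  shows "card (open_nbhd G v) = out_degree G v"
proof -
  have "open_nbhd G v = head G ` out_arcs G v"
    by (auto simp: open_nbhd_def out_arcs_def arcs_ends_def arc_to_ends_def image_iff)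
  moreover have "inj_on (head G) (out_arcs G v)"
    by (auto simp: inj_on_def out_arcs_def arc_to_ends_def intro!: no_multi_arcs)
  ultimately show ?thesis
    by (simp add: card_image out_degree_def)
qed

(* The parameters k and d - k with 1 \<le> k < d lie in the intended ranges for a d-regular graph. *)
lemma (in graph) regular_degrees:
  assumes "regular d G" "verts G \<noteq> {}"
  shows "min_degree G = d" "max_degree G = d"
proof -
  have "out_degree G ` verts G = {d}"
    using assms by (auto simp: regular_def)
  then show "min_degree G = d" "max_degree G = d"
    by (simp_all add: min_degree_def max_degree_def)
qed

(* The minima defining the two numbers range over nonempty families. *)
lemma (in graph) limited_dominating_set_verts: "limited_dominating_set k G (verts G)"
proof -
  have "card (open_nbhd G u - verts G) = 0" for u
    by (auto simp: open_nbhd_def)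
  then show ?thesis
    by (auto simp only: limited_dominating_set_def dominating_set_def Diff_cancel)
qed

lemma (in graph) one_t_dominating_set_verts:
  assumes "t \<le> min_degree G"
  shows "one_t_dominating_set t G (verts G)"
proof -
  have "open_nbhd G v \<inter> verts G = open_nbhd G v" for v
    by (auto simp: open_nbhd_def)
  moreover have "t \<le> out_degree G v" if "v \<in> verts G" for v
    using assms that unfolding min_degree_def
    by (meson Min_le finite_imageI finite_verts image_eqI le_trans)
  ultimately show ?thesis
    by (simp add: one_t_dominating_set_def card_open_nbhd)
qed

end

theory Submission
  imports Defs
begin

text \<open>
  In a \<open>d\<close>-regular graph a vertex \<open>u\<close> of a set \<open>D\<close> has \<open>d\<close> neighbors, split into those inside and
  those outside \<open>D\<close>. Hence at most \<open>k\<close> of them lie outside exactly if at least \<open>d - k\<close> lie inside,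
  so the \<open>k\<close>-limited dominating sets are the very sets that are \<open>(1, d - k)\<close>-dominating
  (\<open>regular_limited_iff_one_t\<close>), and the two minima range over the same family.
\<close>

lemma (in graph) finite_open_nbhd: "finite (open_nbhd G v)"
  by (simp add: open_nbhd_def)

lemma (in graph) card_nbhd_inside_plus_outside:
  assumes "v \<in> verts G"
  shows "card (open_nbhd G v \<inter> D) + card (open_nbhd G v - D) = out_degree G v"
  using card_Int_Diff[OF finite_open_nbhd, of v D] card_open_nbhd[OF assms] by simp

lemma (in graph) regular_limited_iff_one_t:
  assumes "regular d G" and "k \<le> d"
  shows "limited_dominating_set k G D \<longleftrightarrow> one_t_dominating_set (d - k) G D"
proof -
  have "card (open_nbhd G u - D) \<le> k \<longleftrightarrow> d - k \<le> card (open_nbhd G u \<inter> D)"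
    if "u \<in> verts G" for u
  proof -
    have "card (open_nbhd G u \<inter> D) + card (open_nbhd G u - D) = d"
      using card_nbhd_inside_plus_outside[OF that] assms(1) that by (simp add: regular_def)
    then show ?thesis
      using assms(2) by linarith
  qed
  moreover have "open_nbhd G v \<inter> D \<noteq> {} \<longleftrightarrow> 1 \<le> card (open_nbhd G v \<inter> D)" for v
    using finite_open_nbhd[of v] by (simp add: Suc_le_eq card_gt_0_iff)
  ultimately show ?thesis
    unfolding limited_dominating_set_def dominating_set_def one_t_dominating_set_def
    by blast
qed

theorem corollary10:
  fixes G :: "('a, 'b) pre_digraph" and n d k :: nat
  assumes "graph G"
    and "connected G"
    and "regular d G"
    and "card (verts G) = n"
    and "n \<ge> 3"
    and "1 \<le> k"
    and "k < d"
  shows "limited_domination_number k G = one_t_domination_number (d - k) G"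
proof -
  have "limited_dominating_set k G D \<longleftrightarrow> one_t_dominating_set (d - k) G D" for D
    using graph.regular_limited_iff_one_t[OF assms(1) assms(3)] assms(7) by simp
  then show ?thesis
    by (simp add: limited_domination_number_def one_t_domination_number_def)
qed

end
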